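(* Consider the action sums $S_{\rm d}^{k}=\sum_{l=0}^{k-1}L_{\rm d}(q_l,q_{l+1})$ of a discrete Lagrangian $L_{\rm d}$, written in terms of the right discrete Hamiltonian $H_{\rm d}^{+}$: $$S_{\rm d}^{k}(q_k)=\sum_{l=0}^{k-1}\left[p_{l+1}\cdot q_{l+1}-H_{\rm d}^{+}(q_l,p_{l+1})\right],$$ evaluated along a solution of the right discrete Hamilton's equations $$q_{k+1}=D_2H_{\rm d}^{+}(q_k,p_{k+1}),\qquad p_k=D_1H_{\rm d}^{+}(q_k,p_{k+1});$$ each $S_{\rm d}^{k}(q_k)$ is seen as a function of the end point coordinates $q_k$ and the discrete end time $k$. Then these action sums satisfy the discrete Hamilton--Jacobi equation $$S_{\rm d}^{k+1}(q_{k+1})-S_{\rm d}^{k}(q_k)-DS_{\rm d}^{k+1}(q_{k+1})\cdot q_{k+1}+H_{\rm d}^{+}\big(q_k,DS_{\rm d}^{k+1}(q_{k+1})\big)=0.$$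
   Context: $Q$ is an $n$-dimensional differentiable manifold (the configuration space), formulas being written in coordinates; $L_{\rm d}:Q\times Q\to\mathbb{R}$ is a discrete Lagrangian. With the right discrete Legendre transform $p_{k+1}=D_2L_{\rm d}(q_k,q_{k+1})$, the right discrete Hamiltonian is $H_{\rm d}^{+}(q_k,p_{k+1})=p_{k+1}\cdot q_{k+1}-L_{\rm d}(q_k,q_{k+1})$. $D_i$ denotes the derivative with respect to the $i$-th argument, $D$ the derivative of a function of one argument, and $\cdot$ the pairing of momenta (covectors) with positions in coordinates. *)

theory Defs
  imports "HOL-Analysis.Analysis"
begin

text \<open>
  Everything is written in one coordinate chart: positions and momenta are both vectors in
  \<open>real ^ 'n\<close>, the pairing of a momentum with a position is the inner product, and the
  derivative of a real function is its vector of partial derivatives.  Arbitrary values arise at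
  points where the function is not differentiable.
\<close>

definition grad :: "(real ^ 'n \<Rightarrow> real) \<Rightarrow> real ^ 'n \<Rightarrow> real ^ 'n" where
  "grad f x = (THE D. GDERIV f x :> D)"

definition D1 :: "(real ^ 'n \<Rightarrow> real ^ 'n \<Rightarrow> real) \<Rightarrow> real ^ 'n \<Rightarrow> real ^ 'n \<Rightarrow> real ^ 'n" where
  "D1 F x y = grad (\<lambda>x'. F x' y) x"

definition D2 :: "(real ^ 'n \<Rightarrow> real ^ 'n \<Rightarrow> real) \<Rightarrow> real ^ 'n \<Rightarrow> real ^ 'n \<Rightarrow> real ^ 'n" where
  "D2 F x y = grad (\<lambda>y'. F x y') y"

definition discrete_Lagrangian ::
  "(real ^ 'n) set \<Rightarrow> (real ^ 'n \<Rightarrow> real ^ 'n \<Rightarrow> real) \<Rightarrow> bool" where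
  "discrete_Lagrangian Q L \<longleftrightarrow> (\<lambda>(q, q'). L q q') differentiable_on (Q \<times> Q)"

text \<open>
  The map \<open>r\<close> expresses the next position through the current position and the next
  momentum, i.e. it solves the right discrete Legendre transform \<open>p = D2 L q q'\<close> for
  \<open>q'\<close>.  Only a differentiable solution on an open set \<open>W\<close> is required, so a Legendre
  transform that is merely locally invertible is allowed.
\<close>

definition right_Legendre_inverse ::
  "(real ^ 'n) set \<Rightarrow> (real ^ 'n \<Rightarrow> real ^ 'n \<Rightarrow> real) \<Rightarrow> ((real ^ 'n) \<times> (real ^ 'n)) set
    \<Rightarrow> (real ^ 'n \<Rightarrow> real ^ 'n \<Rightarrow> real ^ 'n) \<Rightarrow> bool" where
  "right_Legendre_inverse Q L W r \<longleftrightarrow>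
     open W \<and> (\<lambda>(q, p). r q p) differentiable_on W \<and>
     (\<forall>(q, p) \<in> W. q \<in> Q \<and> r q p \<in> Q \<and> p = D2 L q (r q p))"

definition right_discrete_Hamiltonian ::
  "(real ^ 'n \<Rightarrow> real ^ 'n \<Rightarrow> real) \<Rightarrow> (real ^ 'n \<Rightarrow> real ^ 'n \<Rightarrow> real ^ 'n)
    \<Rightarrow> real ^ 'n \<Rightarrow> real ^ 'n \<Rightarrow> real" where
  "right_discrete_Hamiltonian L r q p = p \<bullet> r q p - L q (r q p)"

definition right_discrete_Hamilton_solution ::
  "((real ^ 'n) \<times> (real ^ 'n)) set \<Rightarrow> (real ^ 'n \<Rightarrow> real ^ 'n \<Rightarrow> real) \<Rightarrow> nat
    \<Rightarrow> (nat \<Rightarrow> real ^ 'n) \<Rightarrow> (nat \<Rightarrow> real ^ 'n) \<Rightarrow> bool" where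
  "right_discrete_Hamilton_solution W H k q p \<longleftrightarrow>
     (\<forall>l<k. (q l, p (Suc l)) \<in> W \<and>
            q (Suc l) = D2 H (q l) (p (Suc l)) \<and>
            p l = D1 H (q l) (p (Suc l)))"

text \<open>
  Along a solution one has \<open>q (Suc l) = r (q l) (p (Suc l))\<close>, because \<open>D2 H q p = r q p\<close> on
  \<open>W\<close> if \<open>H\<close> is the right discrete Hamiltonian of \<open>L\<close>; so the action sum, which is written
  in terms of \<open>H\<close>, is the sum of the \<open>L (q l) (q (Suc l))\<close>.
\<close>

definition action_sum ::
  "(real ^ 'n \<Rightarrow> real ^ 'n \<Rightarrow> real) \<Rightarrow> nat
    \<Rightarrow> (nat \<Rightarrow> real ^ 'n) \<Rightarrow> (nat \<Rightarrow> real ^ 'n) \<Rightarrow> real" where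
  "action_sum H k q p = (\<Sum>l<k. p (Suc l) \<bullet> q (Suc l) - H (q l) (p (Suc l)))"

text \<open>
  To see the action sum as a function of the end point and the end time, one needs for every
  end time \<open>k\<close> and every end point \<open>x\<close> in a region \<open>U k\<close> a solution
  \<open>(qs k x l)\<close>, \<open>(ps k x l)\<close>, \<open>l \<le> k\<close>, of the right discrete Hamilton's
  equations that ends at \<open>x\<close> at time \<open>k\<close>.  The starting position \<open>q0\<close> is the
  same for all of them, and the solution depends differentiably on \<open>x\<close>.  The last clause says
  that cutting off the last step of a solution in the family gives the solution in the family
  with the shorter end time, so that the values at times \<open>k\<close> and \<open>k + 1\<close> are
  evaluated along one and the same solution.  (\<open>U 0\<close> cannot be open, as it is contained in
  \<open>{q0}\<close>.  Some \<open>U k\<close> may be empty, so finite time horizons are covered.)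
\<close>

definition solution_family ::
  "((real ^ 'n) \<times> (real ^ 'n)) set \<Rightarrow> (real ^ 'n \<Rightarrow> real ^ 'n \<Rightarrow> real) \<Rightarrow> real ^ 'n
    \<Rightarrow> (nat \<Rightarrow> (real ^ 'n) set)
    \<Rightarrow> (nat \<Rightarrow> real ^ 'n \<Rightarrow> nat \<Rightarrow> real ^ 'n)
    \<Rightarrow> (nat \<Rightarrow> real ^ 'n \<Rightarrow> nat \<Rightarrow> real ^ 'n) \<Rightarrow> bool" where
  "solution_family W H q0 U qs ps \<longleftrightarrow>
     (\<forall>k\<ge>1. open (U k)) \<and>
     (\<forall>k. \<forall>x\<in>U k. qs k x 0 = q0 \<and> qs k x k = x \<and>
        right_discrete_Hamilton_solution W H k (qs k x) (ps k x)) \<and>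
     (\<forall>k. \<forall>l\<in>{1..k}. (\<lambda>x. qs k x l) differentiable_on U k \<and>
        (\<lambda>x. ps k x l) differentiable_on U k) \<and>
     (\<forall>k. \<forall>x\<in>U (Suc k). let y = qs (Suc k) x k in
        y \<in> U k \<and> (\<forall>l\<in>{1..k}. qs k y l = qs (Suc k) x l \<and> ps k y l = ps (Suc k) x l))"

definition endpoint_action ::
  "(real ^ 'n \<Rightarrow> real ^ 'n \<Rightarrow> real)
    \<Rightarrow> (nat \<Rightarrow> real ^ 'n \<Rightarrow> nat \<Rightarrow> real ^ 'n)
    \<Rightarrow> (nat \<Rightarrow> real ^ 'n \<Rightarrow> nat \<Rightarrow> real ^ 'n)
    \<Rightarrow> nat \<Rightarrow> real ^ 'n \<Rightarrow> real" where
  "endpoint_action H qs ps k x = action_sum H k (qs k x) (ps k x)"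

end

theory Submission
  imports Defs
begin

text \<open>
  Along a family of solutions, Hamilton's equations turn the variation of the \<open>l\<close>-th summand
  \<open>p (l + 1) \<bullet> q (l + 1) - H (q l) (p (l + 1))\<close> into
  \<open>p (l + 1) \<bullet> \<delta>q (l + 1) - p l \<bullet> \<delta>q l\<close>.  The sum telescopes, and since \<open>q 0\<close> is
  fixed and \<open>q k\<close> is the end point itself, the gradient of \<open>S k\<close> is \<open>p k\<close>.
  The Hamilton--Jacobi equation then says that consecutive action sums differ by one summand.
\<close>

lemma grad_eqI:
  fixes f :: "real ^ 'n \<Rightarrow> real"
  assumes "GDERIV f x :> D"
  shows "grad f x = D"
  unfolding grad_def
proof (rule the_equality)
  fix E assume "GDERIV f x :> E"
  then have "(\<lambda>h. h \<bullet> E) = (\<lambda>h. h \<bullet> D)"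
    using assms unfolding gderiv_def by (blast intro: has_derivative_unique)
  then show "E = D"
    by (metis inner_commute vector_eq_ldot)
qed (fact assms)

text \<open>A linear functional on a Euclidean space is the inner product with a vector, here
  \<open>adjoint f' 1\<close>. So differentiability alone makes the description in
  \<open>grad\<close> proper.\<close>

lemma has_derivative_grad:
  fixes f :: "real ^ 'n \<Rightarrow> real"
  assumes "(f has_derivative f') (at x)"
  shows "f' h = h \<bullet> grad f x"
proof -
  have lin: "linear f'"
    using assms by (rule has_derivative_linear)
  have f': "f' = (\<lambda>h. h \<bullet> adjoint f' 1)"
    using adjoint_works[OF lin, of _ 1] by (simp add: fun_eq_iff)
  then have "GDERIV f x :> adjoint f' 1"
    using assms by (simp add: gderiv_def)
  then have "grad f x = adjoint f' 1"
    by (rule grad_eqI)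
  then show ?thesis
    using f' by metis
qed

text \<open>Composing with the slices \<open>(a, y)\<close> and \<open>(x, b)\<close> identifies the
  total derivative on each factor with a partial gradient; linearity then determines it on every
  \<open>(h, j)\<close>.\<close>

lemma has_derivative_partial_grads:
  fixes F :: "real ^ 'n \<Rightarrow> real ^ 'n \<Rightarrow> real"
  assumes "(\<lambda>(a, b). F a b) differentiable (at (x, y))"
  shows "((\<lambda>(a, b). F a b) has_derivative (\<lambda>(h, j). h \<bullet> D1 F x y + j \<bullet> D2 F x y)) (at (x, y))"
proof -
  obtain F' where F': "((\<lambda>(a, b). F a b) has_derivative F') (at (x, y))"
    using assms unfolding differentiable_def by blast
  have "((\<lambda>a. (a, y)) has_derivative (\<lambda>h. (h, 0))) (at x)"
    by (auto intro!: derivative_eq_intros)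
  from diff_chain_at[OF this F'] have "((\<lambda>a. F a y) has_derivative (\<lambda>h. F' (h, 0))) (at x)"
    by (simp add: o_def)
  then have 1: "F' (h, 0) = h \<bullet> D1 F x y" for h
    unfolding D1_def by (rule has_derivative_grad)
  have "((\<lambda>b. (x, b)) has_derivative (\<lambda>h. (0, h))) (at y)"
    by (auto intro!: derivative_eq_intros)
  from diff_chain_at[OF this F'] have "((\<lambda>b. F x b) has_derivative (\<lambda>h. F' (0, h))) (at y)"
    by (simp add: o_def)
  then have 2: "F' (0, j) = j \<bullet> D2 F x y" for j
    unfolding D2_def by (rule has_derivative_grad)
  have "F' (h, j) = F' (h, 0) + F' (0, j)" for h j
    using linear_add[OF has_derivative_linear[OF F'], of "(h, 0)" "(0, j)"] by simp
  then have "F' = (\<lambda>(h, j). h \<bullet> D1 F x y + j \<bullet> D2 F x y)"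
    using 1 2 by auto
  with F' show ?thesis by simp
qed

text \<open>The Hamiltonian is a pairing minus the composite of \<open>L\<close> with the map from
  \<open>(q, p)\<close> to \<open>(q, r q p)\<close>. Since \<open>Q\<close> and \<open>W\<close>
  are open, differentiability on these sets is differentiability at each of their points.\<close>

lemma right_discrete_Hamiltonian_differentiable:
  fixes L :: "real ^ 'n \<Rightarrow> real ^ 'n \<Rightarrow> real"
  assumes "open Q" "discrete_Lagrangian Q L" "right_Legendre_inverse Q L W r"
    and "(q, p) \<in> W"
  shows "(\<lambda>(q, p). right_discrete_Hamiltonian L r q p) differentiable (at (q, p))"
proof -
  have "open W" "(\<lambda>z. r (fst z) (snd z)) differentiable_on W" and Q: "q \<in> Q" "r q p \<in> Q"
    using assms(3,4) unfolding right_Legendre_inverse_def by (auto simp: case_prod_unfold)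
  then have "(\<lambda>z. r (fst z) (snd z)) differentiable (at (q, p))"
    using assms(4) by (simp add: differentiable_on_eq_differentiable_at)
  then obtain r' where r': "((\<lambda>z. r (fst z) (snd z)) has_derivative r') (at (q, p))"
    unfolding differentiable_def by blast
  have "(\<lambda>(q, q'). L q q') differentiable (at (q, r q p))"
    using assms(1,2) Q unfolding discrete_Lagrangian_def
    by (simp add: differentiable_on_eq_differentiable_at open_Times)
  then obtain L' where L': "((\<lambda>(q, q'). L q q') has_derivative L') (at (q, r q p))"
    unfolding differentiable_def by blast
  have "((\<lambda>z. (fst z, r (fst z) (snd z))) has_derivative (\<lambda>h. (fst h, r' h))) (at (q, p))"
    by (intro has_derivative_Pair has_derivative_fst has_derivative_ident r')
  then have "((\<lambda>z. L (fst z) (r (fst z) (snd z))) has_derivative (\<lambda>h. L' (fst h, r' h))) (at (q, p))"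
    using diff_chain_at[of _ _ "(q, p)" "\<lambda>(q, q'). L q q'" L'] L' by (fastforce simp: o_def)
  then have "((\<lambda>z. snd z \<bullet> r (fst z) (snd z) - L (fst z) (r (fst z) (snd z))) has_derivative
      (\<lambda>h. (p \<bullet> r' h + snd h \<bullet> r q p) - L' (fst h, r' h))) (at (q, p))"
    using has_derivative_inner[OF has_derivative_snd[OF has_derivative_ident] r']
    by (auto intro!: has_derivative_diff)
  then show ?thesis
    unfolding differentiable_def right_discrete_Hamiltonian_def by (auto simp: case_prod_unfold)
qed

text \<open>The variation of the momentum \<open>c\<close> cancels: the product rule contributes
  \<open>c' h \<bullet> b x\<close>, and the chain rule subtracts
  \<open>c' h \<bullet> D2 H (a x) (c x)\<close>, which is the same by Hamilton's first
  equation.\<close>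

lemma has_derivative_action_summand:
  fixes H :: "real ^ 'n \<Rightarrow> real ^ 'n \<Rightarrow> real" and a b c :: "real ^ 'm \<Rightarrow> real ^ 'n"
  assumes "(a has_derivative a') (at x)" "(b has_derivative b') (at x)"
    and "(c has_derivative c') (at x)"
    and "(\<lambda>(q, p). H q p) differentiable (at (a x, c x))"
    and "b x = D2 H (a x) (c x)"
  shows "((\<lambda>x. c x \<bullet> b x - H (a x) (c x)) has_derivative
    (\<lambda>h. c x \<bullet> b' h - D1 H (a x) (c x) \<bullet> a' h)) (at x)"
proof -
  have "((\<lambda>x. H (a x) (c x)) has_derivative
      (\<lambda>h. a' h \<bullet> D1 H (a x) (c x) + c' h \<bullet> b x)) (at x)"
    using diff_chain_at[OF has_derivative_Pair[OF assms(1,3)] has_derivative_partial_grads[OF assms(4)]]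
    by (simp add: o_def assms(5))
  from has_derivative_diff[OF has_derivative_inner[OF assms(3,2)] this]
  show ?thesis
    by (simp add: algebra_simps inner_commute)
qed

lemma GDERIV_endpoint_action:
  fixes H :: "real ^ 'n \<Rightarrow> real ^ 'n \<Rightarrow> real"
  assumes H: "\<And>q p. (q, p) \<in> W \<Longrightarrow> (\<lambda>(q, p). H q p) differentiable (at (q, p))"
    and fam: "solution_family W H q0 U qs ps"
    and k: "1 \<le> k" and x: "x \<in> U k"
  shows "GDERIV (endpoint_action H qs ps k) x :> ps k x k"
proof -
  have opn: "open (U k)"
    using fam k unfolding solution_family_def by blast
  have sol: "(qs k x l, ps k x (Suc l)) \<in> W" "qs k x (Suc l) = D2 H (qs k x l) (ps k x (Suc l))"
      "ps k x l = D1 H (qs k x l) (ps k x (Suc l))" if "l < k" for l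
    using fam x that unfolding solution_family_def right_discrete_Hamilton_solution_def by auto
  define Q' where "Q' l = frechet_derivative (\<lambda>x. qs k x l) (at x)" for l
  define P' where "P' l = frechet_derivative (\<lambda>x. ps k x l) (at x)" for l
  have P': "((\<lambda>x. ps k x l) has_derivative P' l) (at x)" if "l \<in> {1..k}" for l
    using fam that x opn unfolding solution_family_def P'_def
    by (metis differentiable_on_eq_differentiable_at frechet_derivative_works)
  \<comment> \<open>Openness of \<open>U k\<close> makes the two end conditions of the family hold
    on a neighbourhood of \<open>x\<close>, so they can be differentiated there.\<close>
  have const: "((\<lambda>x. qs k x 0) has_derivative (\<lambda>h. 0)) (at x)"
    by (rule has_derivative_transform_within_open[OF has_derivative_const opn x, of q0])
      (use fam in \<open>auto simp: solution_family_def\<close>)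
  have ident: "((\<lambda>x. qs k x k) has_derivative (\<lambda>h. h)) (at x)"
    by (rule has_derivative_transform_within_open[OF has_derivative_ident opn x])
      (use fam in \<open>auto simp: solution_family_def\<close>)
  have Q': "((\<lambda>x. qs k x l) has_derivative Q' l) (at x)" if "l \<le> k" for l
  \<comment> \<open>The differentiability clause of the family starts at index 1; at index 0 the
    position is locally constant.\<close>
  proof (cases "l = 0")
    case True
    with const show ?thesis
      unfolding Q'_def by (metis differentiable_def frechet_derivative_works)
  next
    case False
    then have "l \<in> {1..k}"
      using that by simp
    with fam x opn show ?thesis
      unfolding solution_family_def Q'_def
      by (metis differentiable_on_eq_differentiable_at frechet_derivative_works)
  qed
  have Q'0: "Q' 0 = (\<lambda>h. 0)" and Q'k: "Q' k = (\<lambda>h. h)"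
    using const ident Q' has_derivative_unique by blast+
  \<comment> \<open>Only momenta of index at least 1 are differentiated. Hamilton's second equation
    replaces \<open>D1 H\<close> by \<open>ps k x l\<close>, which gives the summand its telescoping
    form.\<close>
  have "((\<lambda>x. ps k x (Suc l) \<bullet> qs k x (Suc l) - H (qs k x l) (ps k x (Suc l))) has_derivative
      (\<lambda>h. ps k x (Suc l) \<bullet> Q' (Suc l) h - ps k x l \<bullet> Q' l h)) (at x)" if "l < k" for l
    using has_derivative_action_summand[OF Q' Q' P' H[OF sol(1)] sol(2), of l] sol(3) that by simp
  then have "(endpoint_action H qs ps k has_derivative
      (\<lambda>h. \<Sum>l<k. ps k x (Suc l) \<bullet> Q' (Suc l) h - ps k x l \<bullet> Q' l h)) (at x)"
    unfolding endpoint_action_def action_sum_def by (intro has_derivative_sum) auto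
  \<comment> \<open>The lower boundary term vanishes because \<open>Q' 0\<close> is zero, whatever
    the initial momentum is; the upper one is the claimed gradient since \<open>Q' k\<close> is the
    identity.\<close>
  moreover have "(\<Sum>l<k. ps k x (Suc l) \<bullet> Q' (Suc l) h - ps k x l \<bullet> Q' l h) = h \<bullet> ps k x k" for h
    using sum_lessThan_telescope[of "\<lambda>l. ps k x l \<bullet> Q' l h" k] by (simp add: Q'0 Q'k inner_commute)
  ultimately show ?thesis
    by (simp add: gderiv_def)
qed

text \<open>The compatibility clause of the family makes the first \<open>k\<close> summands at time
  \<open>Suc k\<close> those of the solution ending at \<open>y\<close> at time \<open>k\<close>, so
  only the last summand is left over.\<close>

lemma endpoint_action_Suc:
  assumes fam: "solution_family W H q0 U qs ps" and x: "x \<in> U (Suc k)"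
  defines "y \<equiv> qs (Suc k) x k"
  shows "endpoint_action H qs ps (Suc k) x =
    endpoint_action H qs ps k y + (ps (Suc k) x (Suc k) \<bullet> x - H y (ps (Suc k) x (Suc k)))"
proof -
  have y: "y \<in> U k" and "\<forall>l\<in>{1..k}. qs k y l = qs (Suc k) x l \<and> ps k y l = ps (Suc k) x l"
    using fam x unfolding solution_family_def y_def Let_def by blast+
  \<comment> \<open>Compatibility says nothing at index 0; there both positions are
    \<open>q0\<close>, and the momentum of index 0 does not enter the sum.\<close>
  moreover have "qs k y 0 = qs (Suc k) x 0"
    using fam x y unfolding solution_family_def by simp
  ultimately have "qs k y l = qs (Suc k) x l" "ps k y (Suc l) = ps (Suc k) x (Suc l)"
      "qs k y (Suc l) = qs (Suc k) x (Suc l)" if "l < k" for l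
    using that by (cases l; simp)+
  moreover have "qs (Suc k) x (Suc k) = x"
    using fam x unfolding solution_family_def by blast
  ultimately show ?thesis
    by (simp add: endpoint_action_def action_sum_def y_def)
qed

theorem theorem3p3:
  fixes Q :: "(real ^ 'n) set"
    and L :: "real ^ 'n \<Rightarrow> real ^ 'n \<Rightarrow> real"
    and W :: "((real ^ 'n) \<times> (real ^ 'n)) set"
    and r :: "real ^ 'n \<Rightarrow> real ^ 'n \<Rightarrow> real ^ 'n"
    and q0 :: "real ^ 'n"
    and U :: "nat \<Rightarrow> (real ^ 'n) set"
    and qs ps :: "nat \<Rightarrow> real ^ 'n \<Rightarrow> nat \<Rightarrow> real ^ 'n"
    and k :: nat and x :: "real ^ 'n"
  defines "H \<equiv> right_discrete_Hamiltonian L r"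
  defines "S \<equiv> endpoint_action H qs ps"
  assumes "open Q"
    and "discrete_Lagrangian Q L"
    and "right_Legendre_inverse Q L W r"
    and "solution_family W H q0 U qs ps"
    and "x \<in> U (Suc k)"
  shows "S (Suc k) differentiable (at x) \<and>
    S (Suc k) x - S k (qs (Suc k) x k) - grad (S (Suc k)) x \<bullet> x
      + H (qs (Suc k) x k) (grad (S (Suc k)) x) = 0"
proof -
  have "GDERIV (S (Suc k)) x :> ps (Suc k) x (Suc k)"
    unfolding S_def
    by (rule GDERIV_endpoint_action[OF _ assms(6)])
      (use assms(3-5,7) in \<open>auto simp: H_def intro!: right_discrete_Hamiltonian_differentiable\<close>)
  then have "S (Suc k) differentiable (at x)" "grad (S (Suc k)) x = ps (Suc k) x (Suc k)"
    by (auto simp: gderiv_def differentiable_def intro!: grad_eqI)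
  \<comment> \<open>With the gradient identified as the final momentum, the equation is the one-step
    recursion of the action sums, rearranged.\<close>
  then show ?thesis
    using endpoint_action_Suc[OF assms(6,7)] by (simp add: S_def)
qed

end
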